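(* Let $G=(V(G),E(G))$ be a finite graph with $|V(G)|=n$ vertices. For every real $q>1$, $w\ge 0$ and $B\in\mathbb R$, $$Z^{(2)}_G(q,w,B)=\big(e^{-B}(q-1)\big)^{n/2}\,e^{\beta^*|E(G)|}\,Z^{\mathrm{eIsing}}_G(\beta^*,k,h),$$ where $$k=\frac14\log\Big(\frac{1+w}{1+w/(q-1)}\Big),\qquad \beta^*=\frac14\log\big((1+w)(1+w/(q-1))\big),\qquad h=\frac12\log\Big(\frac{e^B}{q-1}\Big).$$
   Context: With $E(S)$ the set of edges of $G$ having both endpoints in $S\subseteq V(G)$, $$Z^{(2)}_G(q,w,B)=\sum_{S\subseteq V(G)}(1+w)^{|E(S)|}\Big(1+\frac{w}{q-1}\Big)^{|E(V(G)\setminus S)|}\big((q-1)e^{-B}\big)^{|V(G)|-|S|}.$$ The extended Ising partition function is $$Z^{\mathrm{eIsing}}_G(\beta,k,h)=\sum_{\sigma\in\{-1,1\}^{V(G)}}\exp\Big(\beta\sum_{\{u,v\}\in E(G)}\sigma_u\sigma_v+\sum_{v\in V(G)}(k d_v+h)\sigma_v\Big),$$ where $d_v$ is the degree of $v$ in $G$. *)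

theory Defs
  imports Complex_Main "HOL-Library.FuncSet"
begin

text \<open>Graphs are simple and undirected: a vertex set together with a set of two-element
  sets of vertices.\<close>

definition finite_graph :: "'v set \<Rightarrow> 'v set set \<Rightarrow> bool" where
  "finite_graph V E \<longleftrightarrow> finite V \<and> (\<forall>e\<in>E. e \<subseteq> V \<and> card e = 2)"

definition induced_edges :: "'v set set \<Rightarrow> 'v set \<Rightarrow> 'v set set" where
  "induced_edges E S = {e \<in> E. e \<subseteq> S}"

definition degree :: "'v set set \<Rightarrow> 'v \<Rightarrow> nat" where
  "degree E v = card {e \<in> E. v \<in> e}"

definition Z2 :: "'v set \<Rightarrow> 'v set set \<Rightarrow> real \<Rightarrow> real \<Rightarrow> real \<Rightarrow> real" where
  "Z2 V E q w B =
     (\<Sum>S\<in>Pow V. (1 + w) ^ card (induced_edges E S)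
        * (1 + w / (q - 1)) ^ card (induced_edges E (V - S))
        * ((q - 1) * exp (- B)) ^ (card V - card S))"

text \<open>Spin configurations are extensional functions (constantly \<open>undefined\<close> off \<open>V\<close>), so that
  each assignment of spins to \<open>V\<close> is summed exactly once. Since an edge \<open>e = {u, v}\<close> has two
  distinct endpoints, \<open>\<Prod>x\<in>e. \<sigma> x\<close> is the product of \<open>\<sigma> u\<close> and \<open>\<sigma> v\<close>.\<close>

definition Z_eIsing :: "'v set \<Rightarrow> 'v set set \<Rightarrow> real \<Rightarrow> real \<Rightarrow> real \<Rightarrow> real" where
  "Z_eIsing V E \<beta> k h =
     (\<Sum>\<sigma>\<in>V \<rightarrow>\<^sub>E {-1, 1}.
        exp (\<beta> * (\<Sum>e\<in>E. \<Prod>x\<in>e. \<sigma> x) + (\<Sum>v\<in>V. (k * real (degree E v) + h) * \<sigma> v)))"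

end

theory Submission imports Defs begin

text \<open>A vertex set \<open>S \<subseteq> V\<close> corresponds to the spin configuration that is \<open>1\<close> on \<open>S\<close> and \<open>-1\<close> on
  \<open>V - S\<close>, and under this bijection the two sums agree term by term once the prefactor is moved
  inside the Ising sum (\<open>spin_weight\<close>). The prefactor is a product of one factor
  \<open>exp \<beta>\<close> per edge and one factor \<open>c powr (1 / 2)\<close> per vertex. By double counting
  (\<open>sum_degree_mult\<close>), the field \<open>k d\<^sub>v\<close> spreads over the edges, so the Ising weight factors over
  edges and vertices. With \<open>\<beta> = ln (a b) / 4\<close> and \<open>k = ln (a / b) / 4\<close>, an edge contributes
  \<open>exp (\<beta> + \<beta> \<sigma>\<^sub>u \<sigma>\<^sub>v + k (\<sigma>\<^sub>u + \<sigma>\<^sub>v))\<close>, which is \<open>a\<close>, \<open>b\<close> or \<open>1\<close> according to whether the spins are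
  both \<open>1\<close>, both \<open>-1\<close>, or different (\<open>edge_weight\<close>). With \<open>h = - ln c / 2\<close>, a vertex contributes
  \<open>c powr (1 / 2) * exp (h \<sigma>\<^sub>v)\<close>, which is \<open>1\<close> for spin \<open>1\<close> and \<open>c\<close> for spin \<open>-1\<close> (\<open>vertex_weight\<close>).
  The theorem is the case \<open>a = 1 + w\<close>, \<open>b = 1 + w / (q - 1)\<close>, \<open>c = (q - 1) exp (- B)\<close>.\<close>

lemma finite_graph_finite_edges:
  assumes "finite_graph V E"
  shows "finite E"
proof (rule finite_subset)
  show "E \<subseteq> Pow V" "finite (Pow V)"
    using assms by (auto simp: finite_graph_def)
qed

lemma sum_degree_mult:
  fixes f :: "'v \<Rightarrow> real"
  assumes "finite_graph V E"
  shows "(\<Sum>v\<in>V. real (degree E v) * f v) = (\<Sum>e\<in>E. \<Sum>x\<in>e. f x)"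
proof -
  have fin: "finite V" "finite E" and sub: "\<And>e. e \<in> E \<Longrightarrow> e \<subseteq> V"
    using assms finite_graph_finite_edges by (auto simp: finite_graph_def)
  have "(\<Sum>v\<in>V. real (degree E v) * f v) = (\<Sum>v\<in>V. \<Sum>e | e \<in> E \<and> v \<in> e. f v)"
    by (simp add: degree_def)
  also have "\<dots> = (\<Sum>e\<in>E. \<Sum>v | v \<in> V \<and> v \<in> e. f v)"
    by (rule sum.swap_restrict[OF fin])
  also have "\<dots> = (\<Sum>e\<in>E. \<Sum>x\<in>e. f x)"
    using sub by (intro sum.cong refl) auto
  finally show ?thesis .
qed

text \<open>The configuration with spin \<open>1\<close> exactly on \<open>S\<close>, extensional on \<open>V\<close>.\<close>

definition spin_of :: "'v set \<Rightarrow> 'v set \<Rightarrow> 'v \<Rightarrow> real" where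
  "spin_of V S = (\<lambda>x\<in>V. if x \<in> S then 1 else -1)"

lemma bij_betw_spin_of: "bij_betw (spin_of V) (Pow V) (V \<rightarrow>\<^sub>E {-1, 1})"
proof (rule bij_betw_byWitness[where f' = "\<lambda>\<sigma>. {x \<in> V. \<sigma> x = 1}"])
  show "\<forall>S\<in>Pow V. {x \<in> V. spin_of V S x = 1} = S"
    by (auto simp: spin_of_def split: if_splits)
  show "\<forall>\<sigma>\<in>V \<rightarrow>\<^sub>E {-1, 1}. spin_of V {x \<in> V. \<sigma> x = 1} = \<sigma>"
    by (fastforce simp: spin_of_def PiE_iff extensional_def)
  show "spin_of V ` Pow V \<subseteq> V \<rightarrow>\<^sub>E {-1, 1}"
    by (auto simp: spin_of_def split: if_splits)
  show "(\<lambda>\<sigma>. {x \<in> V. \<sigma> x = 1}) ` (V \<rightarrow>\<^sub>E {-1, 1}) \<subseteq> Pow V"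
    by auto
qed

lemma edge_weight:
  fixes a b :: real
  assumes "a > 0" "b > 0" "e \<subseteq> V" "card e = 2"
    and \<beta>: "\<beta> = ln (a * b) / 4" and k: "k = ln (a / b) / 4"
  shows "exp (\<beta> + \<beta> * (\<Prod>x\<in>e. spin_of V S x) + k * (\<Sum>x\<in>e. spin_of V S x)) =
    (if e \<subseteq> S then a else 1) * (if e \<subseteq> V - S then b else 1)"
proof -
  obtain u v where e: "e = {u, v}" "u \<noteq> v"
    using \<open>card e = 2\<close> by (auto simp: card_2_iff)
  have "2 * \<beta> + 2 * k = ln a" "2 * \<beta> - 2 * k = ln b"
    using assms by (simp_all add: ln_mult ln_div)
  then have "\<beta> + \<beta> + k * 2 = ln a" "\<beta> + \<beta> - k * 2 = ln b"
    by linarith+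
  then have "exp (\<beta> + \<beta> + k * 2) = a" "exp (\<beta> + \<beta> - k * 2) = b"
    using assms by (simp_all only: exp_ln)
  then show ?thesis
    using e \<open>e \<subseteq> V\<close> by (auto simp: spin_of_def)
qed

lemma vertex_weight:
  fixes c :: real
  assumes "c > 0" "v \<in> V"
  shows "c powr (1 / 2) * exp (- ln c / 2 * spin_of V S v) = (if v \<in> V - S then c else 1)"
proof -
  have "c powr (1 / 2) * exp (- ln c / 2 * spin_of V S v) =
      exp (ln c / 2 - ln c / 2 * spin_of V S v)"
    using assms by (simp add: powr_def flip: exp_add)
  then show ?thesis
    using assms by (simp add: spin_of_def)
qed

lemma prod_if_eq_power:
  assumes "finite A"
  shows "(\<Prod>x\<in>A. if P x then c else 1) = (c :: real) ^ card {x \<in> A. P x}"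
  using assms by (simp flip: prod.inter_filter)

lemma spin_weight:
  fixes a b c :: real
  assumes G: "finite_graph V E" and "S \<subseteq> V" and pos: "a > 0" "b > 0" "c > 0"
    and \<beta>: "\<beta> = ln (a * b) / 4" and k: "k = ln (a / b) / 4" and h: "h = - ln c / 2"
  defines "\<sigma> \<equiv> spin_of V S"
  shows "a ^ card (induced_edges E S) * b ^ card (induced_edges E (V - S))
      * c ^ (card V - card S) =
    c powr (real (card V) / 2) * exp (\<beta> * real (card E)) *
      exp (\<beta> * (\<Sum>e\<in>E. \<Prod>x\<in>e. \<sigma> x) + (\<Sum>v\<in>V. (k * real (degree E v) + h) * \<sigma> v))"
proof -
  have fin: "finite V" "finite E" and E: "\<And>e. e \<in> E \<Longrightarrow> e \<subseteq> V \<and> card e = 2"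
    using G finite_graph_finite_edges by (auto simp: finite_graph_def)
  have "(\<Sum>v\<in>V. (k * real (degree E v) + h) * \<sigma> v) =
      k * (\<Sum>e\<in>E. \<Sum>x\<in>e. \<sigma> x) + (\<Sum>v\<in>V. h * \<sigma> v)"
    unfolding sum_degree_mult[OF G, symmetric]
    by (simp add: distrib_right sum.distrib sum_distrib_left mult.assoc)
  then have "\<beta> * real (card E) +
      (\<beta> * (\<Sum>e\<in>E. \<Prod>x\<in>e. \<sigma> x) + (\<Sum>v\<in>V. (k * real (degree E v) + h) * \<sigma> v)) =
      (\<Sum>e\<in>E. \<beta> + \<beta> * (\<Prod>x\<in>e. \<sigma> x) + k * (\<Sum>x\<in>e. \<sigma> x)) + (\<Sum>v\<in>V. h * \<sigma> v)"
    by (simp add: sum.distrib flip: sum_distrib_left)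
  then have "exp (\<beta> * real (card E)) *
      exp (\<beta> * (\<Sum>e\<in>E. \<Prod>x\<in>e. \<sigma> x) + (\<Sum>v\<in>V. (k * real (degree E v) + h) * \<sigma> v)) =
      (\<Prod>e\<in>E. exp (\<beta> + \<beta> * (\<Prod>x\<in>e. \<sigma> x) + k * (\<Sum>x\<in>e. \<sigma> x))) * (\<Prod>v\<in>V. exp (h * \<sigma> v))"
    using fin by (simp only: exp_sum exp_add[of "sum _ E" "sum _ V"] flip: exp_add[of "\<beta> * _"])
  moreover have "c powr (real (card V) / 2) = (\<Prod>v\<in>V. c powr (1 / 2))"
    using pos by (simp add: powr_powr flip: powr_realpow)
  moreover have "(\<Prod>e\<in>E. exp (\<beta> + \<beta> * (\<Prod>x\<in>e. \<sigma> x) + k * (\<Sum>x\<in>e. \<sigma> x))) =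
      a ^ card (induced_edges E S) * b ^ card (induced_edges E (V - S))"
  proof -
    have "(\<Prod>e\<in>E. exp (\<beta> + \<beta> * (\<Prod>x\<in>e. \<sigma> x) + k * (\<Sum>x\<in>e. \<sigma> x))) =
        (\<Prod>e\<in>E. (if e \<subseteq> S then a else 1) * (if e \<subseteq> V - S then b else 1))"
      unfolding \<sigma>_def using E pos \<beta> k by (intro prod.cong refl edge_weight) auto
    then show ?thesis
      using fin by (simp only: prod.distrib prod_if_eq_power induced_edges_def)
  qed
  moreover have "(\<Prod>v\<in>V. c powr (1 / 2)) * (\<Prod>v\<in>V. exp (h * \<sigma> v)) = c ^ (card V - card S)"
  proof -
    have "(\<Prod>v\<in>V. c powr (1 / 2)) * (\<Prod>v\<in>V. exp (h * \<sigma> v)) =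
        (\<Prod>v\<in>V. if v \<in> V - S then c else 1)"
      unfolding \<sigma>_def h prod.distrib[symmetric] using pos
      by (intro prod.cong refl vertex_weight)
    also have "\<dots> = c ^ card (V - S)"
      using fin by (simp only: prod_if_eq_power) (simp add: set_diff_eq)
    finally show ?thesis
      using fin \<open>S \<subseteq> V\<close> by (simp add: card_Diff_subset finite_subset)
  qed
  ultimately show ?thesis
    by (simp only: mult.assoc mult.left_commute[of "prod _ V"])
qed

theorem corollary1p7:
  fixes V :: "'v set" and E :: "'v set set" and n :: nat
    and q w B k \<beta> h :: real
  assumes "finite_graph V E" and "card V = n"
    and "q > 1" and "w \<ge> 0"
    and "k = 1 / 4 * ln ((1 + w) / (1 + w / (q - 1)))"
    and "\<beta> = 1 / 4 * ln ((1 + w) * (1 + w / (q - 1)))"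
    and "h = 1 / 2 * ln (exp B / (q - 1))"
  shows "Z2 V E q w B =
    (exp (- B) * (q - 1)) powr (real n / 2) * exp (\<beta> * real (card E)) * Z_eIsing V E \<beta> k h"
proof -
  have pos: "1 + w > 0" "1 + w / (q - 1) > 0" "(q - 1) * exp (- B) > 0"
    using assms by (auto intro!: add_pos_nonneg)
  have h: "h = - ln ((q - 1) * exp (- B)) / 2"
    using assms by (simp add: ln_mult ln_div)
  have \<beta>: "\<beta> = ln ((1 + w) * (1 + w / (q - 1))) / 4"
    and k: "k = ln ((1 + w) / (1 + w / (q - 1))) / 4"
    using assms by simp_all
  have weight: "(1 + w) ^ card (induced_edges E S)
        * (1 + w / (q - 1)) ^ card (induced_edges E (V - S))
        * ((q - 1) * exp (- B)) ^ (card V - card S) =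
      (exp (- B) * (q - 1)) powr (real n / 2) * exp (\<beta> * real (card E)) *
        exp (\<beta> * (\<Sum>e\<in>E. \<Prod>x\<in>e. spin_of V S x)
          + (\<Sum>v\<in>V. (k * real (degree E v) + h) * spin_of V S v))" if "S \<in> Pow V" for S
    using spin_weight[OF assms(1) _ pos \<beta> k h, of S] that
    by (simp only: Pow_iff \<open>card V = n\<close> mult.commute[of "exp (- B)"])
  show ?thesis
    unfolding Z2_def Z_eIsing_def sum.reindex_bij_betw[OF bij_betw_spin_of, symmetric]
      sum_distrib_left[where A = "Pow V"]
    by (intro sum.cong refl weight)
qed

end
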